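(* Let $d\in\mathbb{N}$ and let $\mathcal P$ be a probability distribution on $\mathbb{R}^d$, $\|\cdot\|$ a norm on $\mathbb{R}^d$, and $R_d,\gamma>0$, $\beta\ge\log 2$ constants such that (i) $\mathcal P(\{x\in\mathbb{R}^d:\|x\|<R_d\})\ge\gamma$, and (ii) $\mathcal P$ has a density $f_{\mathcal P}$ with respect to Lebesgue measure with $$\frac{\operatorname{ess\,sup}_{\|x\|<R_d}f_{\mathcal P}(x)}{\operatorname{ess\,inf}_{\|x\|<R_d}f_{\mathcal P}(x)}\le e^{\beta d}.$$ Let $X_1,\dots,X_n$ be i.i.d. with law $\mathcal P$ and let $M_r$ be a largest matching in the random geometric graph $G(n,r,d,\|\cdot\|)$ on $X_1,\dots,X_n$. Then for all $n\ge 3$ and $r>0$, $$\mathbb{E}\left[|M_r|\right]\ \ge\ \frac{\gamma^2}{16}\,e^{-6\beta d}\left(\left(n^2\left(\frac{r}{R_d}\right)^d\right)\wedge n\right).$$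
   Context: $G(n,r,d,\|\cdot\|)=G(\{X_1,\dots,X_n\},r,d,\|\cdot\|)$ is the graph with vertex set $[n]=\{1,\dots,n\}$ and edge set $\{\{i,j\}\subseteq[n]: i\ne j,\ \|X_i-X_j\|<r\}$. A matching in a graph is a set of edges no two of which share a vertex; a largest matching is one of maximum cardinality, and $|M_r|$ is its number of edges. We write $a\wedge b=\min(a,b)$. *)

theory Defs
  imports "HOL-Probability.Probability"
begin

text \<open>A real vector space type carries one norm by type class; here an arbitrary further norm is needed.\<close>

definition is_norm :: "('a::real_vector \<Rightarrow> real) \<Rightarrow> bool" where
  "is_norm N \<longleftrightarrow>
     (\<forall>x. 0 \<le> N x) \<and>
     (\<forall>x. N x = 0 \<longleftrightarrow> x = 0) \<and>
     (\<forall>c x. N (c *\<^sub>R x) = \<bar>c\<bar> * N x) \<and>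
     (\<forall>x y. N (x + y) \<le> N x + N y)"

text \<open>Dual of \<^const>\<open>esssup\<close>: the largest almost everywhere lower bound.\<close>

definition essinf :: "'a measure \<Rightarrow> ('a \<Rightarrow> ennreal) \<Rightarrow> ennreal" where
  "essinf M f = Sup {c. AE x in M. c \<le> f x}"

text \<open>A graph is a pair of a vertex set and a set of edges, each edge being a set of two vertices.\<close>

definition geometric_graph ::
    "nat \<Rightarrow> real \<Rightarrow> ('a::real_vector \<Rightarrow> real) \<Rightarrow> (nat \<Rightarrow> 'a) \<Rightarrow> nat set \<times> nat set set" where
  "geometric_graph n r N x =
     ({1..n}, {{i, j} | i j. i \<in> {1..n} \<and> j \<in> {1..n} \<and> i \<noteq> j \<and> N (x i - x j) < r})"

definition is_matching :: "'v set \<times> 'v set set \<Rightarrow> 'v set set \<Rightarrow> bool" where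
  "is_matching G M \<longleftrightarrow> M \<subseteq> snd G \<and> (\<forall>e\<in>M. \<forall>e'\<in>M. e \<noteq> e' \<longrightarrow> e \<inter> e' = {})"

text \<open>Meant for graphs with finitely many edges, since \<^const>\<open>card\<close> vanishes on infinite sets.\<close>

definition is_largest_matching :: "'v set \<times> 'v set set \<Rightarrow> 'v set set \<Rightarrow> bool" where
  "is_largest_matching G M \<longleftrightarrow> is_arg_max card (is_matching G) M"

end

theory Submission
  imports Defs
begin

text \<open>
  A finite graph has a matching with at least as many edges as the number of its edges minus the
  number of its pairs of intersecting edges (cherries). Shrinking the radius only shrinks the graph,
  so one may replace \<open>r\<close> by \<open>s \<le> min r (R / 2)\<close> with \<open>(s / R) ^ d \<le> 1 / (2 n b\<^sup>3)\<close>, where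
  \<open>b = exp (\<beta> d)\<close>, and keep only the points of norm less than \<open>R\<close>. The density there is constant
  up to the factor \<open>b\<close>, so small balls have mass comparable to \<open>A (s / R) ^ d\<close> with
  \<open>A \<ge> \<gamma> / b\<close>; in the sparse regime the expected number of cherries is then at most half of the
  lower bound for the expected number of edges.
\<close>

section \<open>Arbitrary norms: measurability and the volume of their balls\<close>

text \<open>A norm is convex by the triangle inequality and homogeneity, and a finite convex
  function on an open set of a Euclidean space is continuous. This avoids comparing \<open>N\<close>
  with the norm of the type class.\<close>

lemma is_norm_continuous_on:
  fixes N :: "'a::euclidean_space \<Rightarrow> real"
  assumes "is_norm N"
  shows "continuous_on UNIV N"
proof (rule convex_on_continuous)
  show "convex_on UNIV N"
    unfolding convex_on_def
  proof (intro conjI ballI allI impI)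
    fix x y :: 'a and u v :: real
    assume "0 \<le> u" "0 \<le> v"
    have "N (u *\<^sub>R x + v *\<^sub>R y) \<le> N (u *\<^sub>R x) + N (v *\<^sub>R y)"
      using assms unfolding is_norm_def by blast
    also have "\<dots> = u * N x + v * N y"
      using assms \<open>0 \<le> u\<close> \<open>0 \<le> v\<close> by (simp add: is_norm_def)
    finally show "N (u *\<^sub>R x + v *\<^sub>R y) \<le> u * N x + v * N y" .
  qed simp
qed simp

lemma is_norm_measurable:
  fixes N :: "'a::euclidean_space \<Rightarrow> real"
  assumes "is_norm N"
  shows "N \<in> borel_measurable borel"
  using is_norm_continuous_on[OF assms] by (rule borel_measurable_continuous_onI)

lemma is_norm_minus_commute:
  assumes "is_norm N"
  shows "N (x - y) = N (y - x)"
proof -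
  have "N ((-1) *\<^sub>R (x - y)) = \<bar>-1\<bar> * N (x - y)"
    using assms unfolding is_norm_def by blast
  then show ?thesis by simp
qed

lemma is_norm_triangle_sub:
  assumes "is_norm N"
  shows "N y \<le> N x + N (x - y)"
proof -
  have "N (x + (y - x)) \<le> N x + N (y - x)"
    using assms unfolding is_norm_def by blast
  then show ?thesis using is_norm_minus_commute[OF assms, of x y] by simp
qed

text \<open>The map \<open>y \<mapsto> x + c *\<^sub>R y\<close> with \<open>c = s / R\<close> pulls
  the ball of radius \<open>s\<close> around \<open>x\<close> back to the centred ball of radius
  \<open>R\<close>, and Lebesgue measure scales by \<open>c ^ DIM('a)\<close>. Only this ratio of
  volumes enters later, never the volume itself.\<close>

lemma emeasure_lborel_norm_ball:
  fixes N :: "'a::euclidean_space \<Rightarrow> real"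
  assumes N: "is_norm N" and "0 < R" "0 < s"
  shows "emeasure lborel {y. N (x - y) < s}
       = ennreal ((s / R) ^ DIM('a)) * emeasure lborel {y. N y < R}"
proof -
  note [measurable] = is_norm_measurable[OF N]
  define c where "c = s / R"
  have c: "c > 0" using assms by (simp add: c_def)
  have eq: "(\<lambda>y. x + c *\<^sub>R y) -` {y. N (x - y) < s} = {y. N y < R}"
  proof -
    have "N (x - (x + c *\<^sub>R y)) = c * N y" for y
    proof -
      have "N ((-c) *\<^sub>R y) = \<bar>-c\<bar> * N y" using N unfolding is_norm_def by blast
      then show ?thesis using c by simp
    qed
    moreover have "c * t < s \<longleftrightarrow> t < R" for t
      using assms by (simp add: c_def field_simps)
    ultimately show ?thesis by auto
  qed
  have "emeasure lborel {y. N (x - y) < s}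
      = emeasure (density (distr lborel borel (\<lambda>y. x + c *\<^sub>R y)) (\<lambda>_. \<bar>c\<bar> ^ DIM('a))) {y. N (x - y) < s}"
    using lborel_affine[of c x] c by simp
  also have "\<dots> = ennreal (c ^ DIM('a)) * emeasure lborel {y. N y < R}"
    using c eq by (simp add: emeasure_density_const emeasure_distr ennreal_power del: vimage_Collect_eq)
  finally show ?thesis by (simp add: c_def)
qed

section \<open>Mass of small balls under a density that is almost constant on a ball\<close>

text \<open>The supremum is that of a countable family of almost everywhere lower bounds, and
  countably many null sets may be discarded at once.\<close>

lemma essinf_AE: "AE x in M. essinf M f \<le> f x"
proof -
  have "{c. AE x in M. c \<le> f x} \<noteq> {}"
    by (auto intro: exI[of _ 0])
  from ennreal_Sup_countable_SUP[OF this] obtain g :: "nat \<Rightarrow> ennreal"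
    where g: "range g \<subseteq> {c. AE x in M. c \<le> f x}" "essinf M f = (SUP i. g i)"
    unfolding essinf_def by auto
  have "AE x in M. \<forall>i. g i \<le> f x"
    using g(1) by (subst AE_all_countable) auto
  then show ?thesis
    by eventually_elim (simp add: g(2) SUP_le_iff)
qed

text \<open>On the ball of radius \<open>R\<close> the density lies between its essential infimum
  \<open>m\<close> and \<open>b * m\<close>; the witness is \<open>A = m * V\<close> with
  \<open>V\<close> the volume of that ball. The lower bound needs the small ball to lie inside the
  large one, while the upper bound cuts the small ball down to it. The bound on
  \<open>\<gamma>\<close> is the upper density bound applied to the whole ball.\<close>

lemma norm_ball_mass:
  fixes N :: "'a::euclidean_space \<Rightarrow> real" and f :: "'a \<Rightarrow> ennreal"
  defines "P \<equiv> density lborel f"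
  assumes P: "prob_space P" and N: "is_norm N" and R: "0 < R" and \<gamma>: "0 < \<gamma>" and b: "0 < b"
    and mass: "\<gamma> \<le> measure P {x. N x < R}"
    and f: "f \<in> borel_measurable borel"
    and ratio: "esssup (restrict_space lborel {x. N x < R}) f
      / essinf (restrict_space lborel {x. N x < R}) f \<le> ennreal b"
  obtains A where "\<gamma> \<le> b * A"
    and "\<And>x s. 0 < s \<Longrightarrow> N x + s \<le> R \<Longrightarrow> A * (s / R) ^ DIM('a) \<le> measure P {y. N (x - y) < s}"
    and "\<And>x s. 0 < s \<Longrightarrow> measure P {y. N y < R \<and> N (x - y) < s} \<le> b * A * (s / R) ^ DIM('a)"
proof -
  interpret P: prob_space P by (rule P)
  note [measurable] = is_norm_measurable[OF N] f
  define B where "B = {x. N x < R}"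
  have B[measurable]: "B \<in> sets borel" unfolding B_def by measurable
  define m where "m = essinf (restrict_space lborel B) f"
  define S where "S = esssup (restrict_space lborel B) f"
  define V where "V = emeasure lborel B"
  have AEm: "AE x in lborel. x \<in> B \<longrightarrow> m \<le> f x"
    using essinf_AE[of "restrict_space lborel B" f]
    by (simp add: AE_restrict_space_iff m_def)
  have AES: "AE x in lborel. x \<in> B \<longrightarrow> f x \<le> S"
    using esssup_AE[of f "restrict_space lborel B"]
    by (simp add: AE_restrict_space_iff S_def)
  have low: "m * emeasure lborel C \<le> emeasure P C" if [measurable]: "C \<in> sets borel" and "C \<subseteq> B" for C
  proof -
    have "m * emeasure lborel C = (\<integral>\<^sup>+x. m * indicator C x \<partial>lborel)"
      by (simp add: nn_integral_cmult_indicator)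
    also have "\<dots> \<le> (\<integral>\<^sup>+x. f x * indicator C x \<partial>lborel)"
      using AEm \<open>C \<subseteq> B\<close> by (intro nn_integral_mono_AE) (auto split: split_indicator)
    also have "\<dots> = emeasure P C"
      by (simp add: P_def emeasure_density)
    finally show ?thesis .
  qed
  have upp: "emeasure P C \<le> S * emeasure lborel C" if [measurable]: "C \<in> sets borel" and "C \<subseteq> B" for C
  proof -
    have "emeasure P C = (\<integral>\<^sup>+x. f x * indicator C x \<partial>lborel)"
      by (simp add: P_def emeasure_density)
    also have "\<dots> \<le> (\<integral>\<^sup>+x. S * indicator C x \<partial>lborel)"
      using AES \<open>C \<subseteq> B\<close> by (intro nn_integral_mono_AE) (auto split: split_indicator)
    also have "\<dots> = S * emeasure lborel C"
      by (simp add: nn_integral_cmult_indicator)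
    finally show ?thesis .
  qed
  have PB: "ennreal \<gamma> \<le> emeasure P B" "emeasure P B \<le> 1"
    using mass by (auto simp: P.emeasure_eq_measure B_def)
  have "ennreal \<gamma> \<le> S * V"
    using PB(1) upp[of B] unfolding V_def by (simp add: order_trans)
  then have SV: "S \<noteq> 0" "V \<noteq> 0" using \<gamma> by auto
  have mV: "m * V \<le> 1" using PB(2) low[of B] unfolding V_def by (simp add: order_trans)
  have m_top: "m \<noteq> top" using mV SV by (auto simp: ennreal_top_mult top_unique)
  \<comment> \<open>In \<open>ennreal\<close> the quotient \<open>0 / 0\<close> is 0, so the bound
    on the ratio alone does not exclude \<open>m = 0\<close>. Positive mass gives
    \<open>S \<noteq> 0\<close>, and then \<open>S / 0\<close> is infinite.\<close>
  have m0: "m \<noteq> 0"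
  proof
    assume "m = 0"
    then have "S / m = top" using SV by (simp add: ennreal_divide_zero)
    then show False using ratio by (simp add: S_def m_def B_def top_unique)
  qed
  \<comment> \<open>Finite volume comes from \<open>m * V \<le> 1\<close> and
    \<open>m \<noteq> 0\<close>, not from boundedness of the norm ball.\<close>
  have V_top: "V \<noteq> top" using mV m0 by (auto simp: ennreal_mult_top top_unique)
  have "S = S / m * m"
    using m0 m_top by (simp add: ennreal_divide_times ennreal_divide_self less_top)
  also have "\<dots> \<le> ennreal b * m"
    using ratio by (intro mult_right_mono) (auto simp: S_def m_def B_def)
  finally have Sm: "S \<le> ennreal b * m" .
  define A where "A = enn2real (m * V)"
  have A: "ennreal A = m * V" and A0: "0 \<le> A"
    using mV by (auto simp: A_def ennreal_enn2real_if top_unique)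
  show ?thesis
  proof
    have "ennreal \<gamma> \<le> ennreal b * m * V"
      using \<open>ennreal \<gamma> \<le> S * V\<close> Sm by (meson mult_right_mono order_trans zero_le)
    also have "\<dots> = ennreal (b * A)"
      using b A0 by (simp add: ennreal_mult A mult.assoc)
    finally show "\<gamma> \<le> b * A"
      using b A0 by (simp add: ennreal_le_iff)
  next
    fix x and s :: real assume s: "0 < s" and xs: "N x + s \<le> R"
    have sub: "{y. N (x - y) < s} \<subseteq> B"
      unfolding B_def using is_norm_triangle_sub[OF N, of _ x] xs
      by (force intro: le_less_trans)
    have "ennreal (A * (s / R) ^ DIM('a)) = m * emeasure lborel {y. N (x - y) < s}"
      unfolding emeasure_lborel_norm_ball[OF N R s] 
      using A0 s R by (simp add: ennreal_mult A V_def B_def mult_ac)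
    also have "\<dots> \<le> emeasure P {y. N (x - y) < s}"
      using sub by (intro low) auto
    finally show "A * (s / R) ^ DIM('a) \<le> measure P {y. N (x - y) < s}"
      by (simp add: P.emeasure_eq_measure)
  next
    fix x and s :: real assume s: "0 < s"
    have "emeasure P {y. N y < R \<and> N (x - y) < s} \<le> S * emeasure lborel {y. N y < R \<and> N (x - y) < s}"
      by (intro upp) (auto simp: B_def)
    also have "\<dots> \<le> ennreal b * m * emeasure lborel {y. N (x - y) < s}"
      using Sm by (intro mult_mono emeasure_mono) auto
    also have "\<dots> = ennreal (b * A * (s / R) ^ DIM('a))"
      unfolding emeasure_lborel_norm_ball[OF N R s]
      using A0 s R b by (simp add: ennreal_mult A V_def B_def mult_ac)
    finally show "measure P {y. N y < R \<and> N (x - y) < s} \<le> b * A * (s / R) ^ DIM('a)"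
      using A0 s R b by (simp add: P.emeasure_eq_measure)
  qed
qed

section \<open>Matchings from edge and cherry counts\<close>

text \<open>Greedy choice, one edge \<open>a\<close> at a time. If \<open>a\<close> meets some
  \<open>e\<close> in the current matching, the matching stays and the new intersecting pair
  \<open>{a, e}\<close> pays for \<open>a\<close>; otherwise \<open>a\<close> joins the
  matching.\<close>

lemma exists_matching_card_ge:
  assumes "finite E"
  shows "\<exists>M\<subseteq>E. (\<forall>e\<in>M. \<forall>e'\<in>M. e \<noteq> e' \<longrightarrow> e \<inter> e' = {}) \<and>
    card E \<le> card M + card {{e, e'} | e e'. e \<in> E \<and> e' \<in> E \<and> e \<noteq> e' \<and> e \<inter> e' \<noteq> {}}"
  using assms
proof (induction E)
  case empty
  then show ?case by simp
next
  case (insert a E)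
  define C where "C F = {{e, e'} | e e'. e \<in> F \<and> e' \<in> F \<and> e \<noteq> e' \<and> e \<inter> e' \<noteq> {}}" for F :: "'a set set"
  have finC: "finite (C F)" if "finite F" for F
    by (rule finite_subset[of _ "Pow F"]) (use that in \<open>auto simp: C_def\<close>)
  have C_mono: "C E \<subseteq> C (insert a E)" by (auto simp: C_def)
  obtain M where M: "M \<subseteq> E" "\<forall>e\<in>M. \<forall>e'\<in>M. e \<noteq> e' \<longrightarrow> e \<inter> e' = {}" "card E \<le> card M + card (C E)"
    using insert.IH unfolding C_def by blast
  have finM: "finite M" using M(1) insert.hyps(1) finite_subset by blast
  show ?case
  proof (cases "\<exists>e\<in>M. a \<inter> e \<noteq> {}")
    case True
    then obtain e where e: "e \<in> M" "a \<inter> e \<noteq> {}" by blast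
    have "{a, e} \<in> C (insert a E)" using e M(1) insert.hyps(2) by (auto simp: C_def)
    moreover have "{a, e} \<notin> C E"
      using insert.hyps(2) by (auto simp: C_def doubleton_eq_iff)
    ultimately have "C E \<subset> C (insert a E)" using C_mono by blast
    then have "card (C E) < card (C (insert a E))"
      using finC insert.hyps(1) by (intro psubset_card_mono) auto
    then show ?thesis
      using M insert.hyps unfolding C_def[symmetric] by (intro exI[of _ M]) auto
  next
    case False
    have "a \<notin> M" using M(1) insert.hyps(2) by blast
    moreover have "card (C E) \<le> card (C (insert a E))"
      using C_mono finC insert.hyps(1) by (intro card_mono) auto
    ultimately have "card (insert a E) \<le> card (insert a M) + card (C (insert a E))"
      using M(3) finM insert.hyps by simp
    moreover have "\<forall>e\<in>insert a M. \<forall>e'\<in>insert a M. e \<noteq> e' \<longrightarrow> e \<inter> e' = {}"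
      using M(2) False by blast
    ultimately show ?thesis
      using M(1) unfolding C_def[symmetric] by (intro exI[of _ "insert a M"]) auto
  qed
qed

text \<open>Restates the greedy bound as a linear combination of indicators, so that expectations
  can be taken term by term. A cherry is indexed by its two ends \<open>i < k\<close> and its centre
  \<open>j\<close>.\<close>

lemma exists_matching_edges_minus_cherries:
  fixes V :: "'v::linorder set" and A :: "'v \<Rightarrow> 'v \<Rightarrow> bool"
  assumes V: "finite V" and sym: "\<And>i j. A i j \<Longrightarrow> A j i"
  defines "Q \<equiv> {(i, k). i \<in> V \<and> k \<in> V \<and> i < k}"
  shows "\<exists>M\<subseteq>{{i, k} | i k. i \<in> V \<and> k \<in> V \<and> i \<noteq> k \<and> A i k}.
    (\<forall>e\<in>M. \<forall>e'\<in>M. e \<noteq> e' \<longrightarrow> e \<inter> e' = {}) \<and>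
    (\<Sum>(i, k)\<in>Q. of_bool (A i k) - (\<Sum>j\<in>V. of_bool (j \<noteq> i \<and> j \<noteq> k \<and> A j i \<and> A j k))) \<le> real (card M)"
proof -
  define E where "E = {{i, k} | i k. i \<in> V \<and> k \<in> V \<and> i \<noteq> k \<and> A i k}"
  define C where "C = {{e, e'} | e e'. e \<in> E \<and> e' \<in> E \<and> e \<noteq> e' \<and> e \<inter> e' \<noteq> {}}"
  have finE: "finite E"
    by (rule finite_subset[of _ "Pow V"]) (use V in \<open>auto simp: E_def\<close>)
  obtain M where M: "M \<subseteq> E" "\<forall>e\<in>M. \<forall>e'\<in>M. e \<noteq> e' \<longrightarrow> e \<inter> e' = {}" "card E \<le> card M + card C"
    using exists_matching_card_ge[OF finE] unfolding C_def by blast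
  have finQ: "finite Q"
    by (rule finite_subset[of _ "V \<times> V"]) (use V in \<open>auto simp: Q_def\<close>)
  define Q1 where "Q1 = {q \<in> Q. A (fst q) (snd q)}"
  define T where "T = {(q, j). q \<in> Q \<and> j \<in> V \<and> j \<noteq> fst q \<and> j \<noteq> snd q \<and> A j (fst q) \<and> A j (snd q)}"
  have "inj_on (\<lambda>(i, k). {i, k}) Q1"
    by (auto simp: inj_on_def Q1_def Q_def doubleton_eq_iff)
  then have "card Q1 = card ((\<lambda>(i, k). {i, k}) ` Q1)" by (simp add: card_image)
  also have "\<dots> \<le> card E"
  proof (intro card_mono finE subsetI)
    fix e assume "e \<in> (\<lambda>(i, k). {i, k}) ` Q1"
    then obtain i k where "e = {i, k}" "i \<in> V" "k \<in> V" "i < k" "A i k"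
      by (auto simp: Q1_def Q_def)
    moreover from \<open>i < k\<close> have "i \<noteq> k" by simp
    ultimately show "e \<in> E" unfolding E_def by blast
  qed
  finally have cQ1: "card Q1 \<le> card E" .
  have finT: "finite T"
    by (rule finite_subset[of _ "Q \<times> V"]) (use V finQ in \<open>auto simp: T_def\<close>)
  \<comment> \<open>Every unordered pair of intersecting edges comes from such a triple, which
    bounds \<open>card C\<close> by \<open>card T\<close>.\<close>
  have "C \<subseteq> (\<lambda>((i, k), j). {{j, i}, {j, k}}) ` T"
  proof
    fix c assume "c \<in> C"
    then obtain e e' j where c: "c = {e, e'}" "e \<in> E" "e' \<in> E" "e \<noteq> e'" "j \<in> e" "j \<in> e'"
      unfolding C_def by blast
    have *: "\<exists>i. e = {j, i} \<and> i \<in> V \<and> j \<in> V \<and> i \<noteq> j \<and> A j i" if "e \<in> E" "j \<in> e" for e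
      using that sym unfolding E_def by (auto simp: insert_commute)
    obtain i where i: "e = {j, i}" "i \<in> V" "j \<in> V" "i \<noteq> j" "A j i" using * c by blast
    obtain k where k: "e' = {j, k}" "k \<in> V" "k \<noteq> j" "A j k" using * c by blast
    \<comment> \<open>Distinct edges sharing \<open>j\<close> have distinct other ends; ordering
      these ends gives the index in \<open>T\<close>.\<close>
    have "i \<noteq> k" using c i k by auto
    then consider "i < k" | "k < i" by fastforce
    then show "c \<in> (\<lambda>((i, k), j). {{j, i}, {j, k}}) ` T"
    proof cases
      case 1
      then have "((i, k), j) \<in> T" using i k by (auto simp: T_def Q_def)
      then show ?thesis using c i k by (intro image_eqI[of _ _ "((i, k), j)"]) auto
    next
      case 2
      then have "((k, i), j) \<in> T" using i k by (auto simp: T_def Q_def)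
      then show ?thesis using c i k by (intro image_eqI[of _ _ "((k, i), j)"]) auto
    qed
  qed
  then have cC: "card C \<le> card T" using finT by (rule surj_card_le[rotated])
  have "(\<Sum>(i, k)\<in>Q. of_bool (A i k) - (\<Sum>j\<in>V. of_bool (j \<noteq> i \<and> j \<noteq> k \<and> A j i \<and> A j k)))
      = (\<Sum>q\<in>Q. of_bool (A (fst q) (snd q))) -
        (\<Sum>q\<in>Q. \<Sum>j\<in>V. of_bool (j \<noteq> fst q \<and> j \<noteq> snd q \<and> A j (fst q) \<and> A j (snd q)) :: real)"
    by (simp add: sum_subtractf case_prod_beta)
  also have "(\<Sum>q\<in>Q. of_bool (A (fst q) (snd q))) = real (card Q1)"
    using finQ by (simp add: Q1_def Int_def)
  also have "(\<Sum>q\<in>Q. \<Sum>j\<in>V. of_bool (j \<noteq> fst q \<and> j \<noteq> snd q \<and> A j (fst q) \<and> A j (snd q)))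
      = real (card T)"
  proof -
    have "T = (SIGMA q:Q. {j \<in> V. j \<noteq> fst q \<and> j \<noteq> snd q \<and> A j (fst q) \<and> A j (snd q)})"
      by (auto simp: T_def)
    then show ?thesis
      using finQ V by (simp add: card_SigmaI Int_def)
  qed
  finally show ?thesis
    using M cQ1 cC unfolding E_def[symmetric] by (intro exI[of _ M]) auto
qed

lemma card_increasing_pairs:
  "real (card {(i, k). i \<in> {1..n} \<and> k \<in> {1..n::nat} \<and> i < k}) = real n * (real n - 1) / 2"
proof -
  have "{(i, k). i \<in> {1..n} \<and> k \<in> {1..n} \<and> i < k} = prod.swap ` (SIGMA k:{1..n}. {1..<k})"
    by (auto simp: image_iff)
  then have "card {(i, k). i \<in> {1..n} \<and> k \<in> {1..n} \<and> i < k} = (\<Sum>k\<in>{1..n}. k - 1)"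
    by (simp add: card_image card_SigmaI)
  moreover have "real (\<Sum>k\<in>{1..n}. k - 1) = real n * (real n - 1) / 2"
    by (induction n) (simp_all add: field_simps)
  ultimately show ?thesis by simp
qed

section \<open>Edge and cherry probabilities for independent points\<close>

context prob_space
begin

lemma indep_vars_pair:
  assumes X: "indep_vars (\<lambda>_. borel) X I" and I: "i \<in> I" "k \<in> I" "i \<noteq> k"
  shows "indep_var borel (X i) borel (X k)"
proof -
  have "indep_var borel ((\<lambda>g. g i) \<circ> (\<lambda>\<omega>. restrict (\<lambda>i. X i \<omega>) {i}))
                  borel ((\<lambda>g. g k) \<circ> (\<lambda>\<omega>. restrict (\<lambda>i. X i \<omega>) {k}))"
    by (rule indep_var_compose[OF indep_var_restrict[OF X]]) (use I in auto)
  then show ?thesis by (simp add: comp_def)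
qed

text \<open>\<^const>\<open>indep_var\<close> only relates variables of equal type, hence the doubled \<open>X j\<close>.\<close>

lemma indep_vars_triple:
  fixes X :: "'i \<Rightarrow> 'a \<Rightarrow> 'b::topological_space"
  assumes X: "indep_vars (\<lambda>_. borel) X I" and I: "i \<in> I" "k \<in> I" "j \<in> I" "j \<noteq> i" "j \<noteq> k"
  shows "indep_var (borel \<Otimes>\<^sub>M borel) (\<lambda>\<omega>. (X j \<omega>, X j \<omega>)) (borel \<Otimes>\<^sub>M borel) (\<lambda>\<omega>. (X i \<omega>, X k \<omega>))"
proof -
  have "indep_var (borel \<Otimes>\<^sub>M borel) ((\<lambda>g. (g j, g j)) \<circ> (\<lambda>\<omega>. restrict (\<lambda>i. X i \<omega>) {j}))
          (borel \<Otimes>\<^sub>M borel) ((\<lambda>g. (g i, g k)) \<circ> (\<lambda>\<omega>. restrict (\<lambda>i. X i \<omega>) {i, k}))"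
    by (rule indep_var_compose[OF indep_var_restrict[OF X]]) (use I in auto)
  then show ?thesis by (simp add: comp_def)
qed

text \<open>By independence the pair has law \<open>P \<Otimes>\<^sub>M P\<close>, so the
  probability is the integral over the first point of the masses of its sections. Keeping only first
  points in \<open>D\<close> leaves sections of mass at least \<open>c\<close>.\<close>

lemma iid_pair_prob_ge:
  fixes X :: "'i \<Rightarrow> 'a \<Rightarrow> 'b::second_countable_topology"
  assumes X: "indep_vars (\<lambda>_. borel) X I" and I: "i \<in> I" "k \<in> I" "i \<noteq> k"
    and law: "\<And>i. i \<in> I \<Longrightarrow> distr M borel (X i) = P"
    and D: "D \<in> sets borel" and A: "Measurable.pred (borel \<Otimes>\<^sub>M borel) (\<lambda>(x, y). A x y)"
    and ge: "\<And>x. x \<in> D \<Longrightarrow> c \<le> measure P {y. A x y}" and c: "0 \<le> c"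
  shows "measure P D * c \<le> \<P>(\<omega> in M. A (X i \<omega>) (X k \<omega>))"
proof -
  have Xm[measurable]: "X i \<in> borel_measurable M" "X k \<in> borel_measurable M"
    using X I by (auto simp: indep_vars_def)
  interpret P: prob_space P
    using law[OF I(1), symmetric] Xm(1) by (simp add: prob_space_distr)
  have sP[simp, measurable_cong]: "sets P = sets borel" and spP[simp]: "space P = UNIV"
    using law[OF I(1), symmetric] by auto
  note [measurable] = D A
  have A': "{(x, y). A x y} \<in> sets (borel \<Otimes>\<^sub>M borel)"
    using A by (simp add: pred_def space_pair_measure)
  have joint: "distr M (borel \<Otimes>\<^sub>M borel) (\<lambda>\<omega>. (X i \<omega>, X k \<omega>)) = P \<Otimes>\<^sub>M P"
    using indep_var_distribution_eq[THEN iffD1, OF indep_vars_pair[OF X I]] law I by simp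
  have "ennreal (measure P D * c) = (\<integral>\<^sup>+x. ennreal c * indicator D x \<partial>P)"
    using c by (simp add: nn_integral_cmult_indicator P.emeasure_eq_measure ennreal_mult mult.commute)
  also have "\<dots> \<le> (\<integral>\<^sup>+x. emeasure P (Pair x -` {(x, y). A x y}) \<partial>P)"
    using ge by (intro nn_integral_mono) (auto simp: P.emeasure_eq_measure vimage_def split: split_indicator)
  also have "\<dots> = emeasure (P \<Otimes>\<^sub>M P) {(x, y). A x y}"
    by (rule P.emeasure_pair_measure_alt[symmetric])
       (use A' in \<open>simp cong: sets_pair_measure_cong\<close>)
  also have "\<dots> = emeasure M {\<omega> \<in> space M. A (X i \<omega>) (X k \<omega>)}"
    unfolding joint[symmetric]
    by (subst emeasure_distr[OF _ A']) (auto intro!: arg_cong[where f="emeasure M"])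
  finally show ?thesis by (simp add: emeasure_eq_measure)
qed

text \<open>Given the centre \<open>X j\<close>, the two ends are independent, so each section of
  the event is a square \<open>{y. A x y} \<times> {y. A x y}\<close> of mass at most
  \<open>c\<^sup>2\<close>. Integrating over the centre keeps the bound.\<close>

lemma iid_cherry_prob_le:
  fixes X :: "'i \<Rightarrow> 'a \<Rightarrow> 'b::second_countable_topology"
  assumes X: "indep_vars (\<lambda>_. borel) X I"
    and I: "i \<in> I" "k \<in> I" "j \<in> I" "i \<noteq> k" "j \<noteq> i" "j \<noteq> k"
    and law: "\<And>i. i \<in> I \<Longrightarrow> distr M borel (X i) = P"
    and A: "Measurable.pred (borel \<Otimes>\<^sub>M borel) (\<lambda>(x, y). A x y)"
    and le: "\<And>x. measure P {y. A x y} \<le> c" 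
  shows "\<P>(\<omega> in M. A (X j \<omega>) (X i \<omega>) \<and> A (X j \<omega>) (X k \<omega>)) \<le> c\<^sup>2"
proof -
  have Xm[measurable]: "X i \<in> borel_measurable M" "X k \<in> borel_measurable M" "X j \<in> borel_measurable M"
    using X I by (auto simp: indep_vars_def)
  interpret P: prob_space P
    using law[OF I(1), symmetric] Xm(1) by (simp add: prob_space_distr)
  have sP[simp, measurable_cong]: "sets P = sets borel" and spP[simp]: "space P = UNIV"
    using law[OF I(1), symmetric] by auto
  interpret PP: pair_prob_space P P ..
  note [measurable] = A
  have joint: "distr M (borel \<Otimes>\<^sub>M borel) (\<lambda>\<omega>. (X i \<omega>, X k \<omega>)) = P \<Otimes>\<^sub>M P"
    using indep_var_distribution_eq[THEN iffD1, OF indep_vars_pair[OF X I(1,2,4)]] law I by simp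
  define D where "D = distr M (borel \<Otimes>\<^sub>M borel) (\<lambda>\<omega>. (X j \<omega>, X j \<omega>))"
  interpret D: prob_space D unfolding D_def by (rule prob_space_distr) measurable
  have sD: "sets D = sets (borel \<Otimes>\<^sub>M borel)" by (simp add: D_def)
  have joint3: "distr M ((borel \<Otimes>\<^sub>M borel) \<Otimes>\<^sub>M (borel \<Otimes>\<^sub>M borel))
      (\<lambda>\<omega>. ((X j \<omega>, X j \<omega>), (X i \<omega>, X k \<omega>))) = D \<Otimes>\<^sub>M (P \<Otimes>\<^sub>M P)"
    using indep_var_distribution_eq[THEN iffD1, OF indep_vars_triple[OF X I(1,2,3,5,6)]] joint
    by (simp add: D_def)
  \<comment> \<open>The centre appears as a doubled pair, of which \<open>T\<close> reads only the
    first component.\<close>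
  define T where "T = {t :: ('b \<times> 'b) \<times> 'b \<times> 'b. A (fst (fst t)) (fst (snd t)) \<and> A (fst (fst t)) (snd (snd t))}"
  have T: "T \<in> sets ((borel \<Otimes>\<^sub>M borel) \<Otimes>\<^sub>M (borel \<Otimes>\<^sub>M borel))"
  proof -
    have "Measurable.pred ((borel \<Otimes>\<^sub>M borel) \<Otimes>\<^sub>M (borel \<Otimes>\<^sub>M borel)) (\<lambda>t.
      (\<lambda>(x, y). A x y) (fst (fst t), fst (snd t)) \<and> (\<lambda>(x, y). A x y) (fst (fst t), snd (snd t)))"
      by measurable
    then show ?thesis by (simp add: pred_def T_def space_pair_measure)
  qed
  have "emeasure M {\<omega> \<in> space M. A (X j \<omega>) (X i \<omega>) \<and> A (X j \<omega>) (X k \<omega>)}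
      = emeasure (D \<Otimes>\<^sub>M (P \<Otimes>\<^sub>M P)) T"
    unfolding joint3[symmetric]
    by (subst emeasure_distr[OF _ T])
       (auto simp: T_def intro!: arg_cong[where f="emeasure M"])
  also have "\<dots> = (\<integral>\<^sup>+x. emeasure (P \<Otimes>\<^sub>M P) (Pair x -` T) \<partial>D)"
    by (rule PP.emeasure_pair_measure_alt)
       (use T in \<open>simp add: sD cong: sets_pair_measure_cong\<close>)
  also have "\<dots> \<le> (\<integral>\<^sup>+x. ennreal (c\<^sup>2) \<partial>D)"
  proof (intro nn_integral_mono)
    fix p :: "'b \<times> 'b"
    define x where "x = fst p"
    have s: "{y. A x y} \<in> sets P"
    proof -
      have "Measurable.pred borel (\<lambda>y. (\<lambda>(x, y). A x y) (x, y))" by measurable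
      then show ?thesis by (simp add: pred_def)
    qed
    have "Pair p -` T = {y. A x y} \<times> {y. A x y}" by (auto simp: T_def x_def)
    then have "emeasure (P \<Otimes>\<^sub>M P) (Pair p -` T) = emeasure P {y. A x y} * emeasure P {y. A x y}"
      using s by (simp add: P.emeasure_pair_measure_Times)
    also have "\<dots> = ennreal ((measure P {y. A x y})\<^sup>2)"
      by (simp add: P.emeasure_eq_measure ennreal_mult power2_eq_square)
    also have "\<dots> \<le> ennreal (c\<^sup>2)"
      using le[of x] by (intro ennreal_leI power_mono) auto
    finally show "emeasure (P \<Otimes>\<^sub>M P) (Pair p -` T) \<le> ennreal (c\<^sup>2)" .
  qed
  also have "\<dots> = ennreal (c\<^sup>2)" using D.emeasure_space_1 by simp
  finally show ?thesis by (simp add: emeasure_eq_measure)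
qed

end

section \<open>Measurability and expectations of indicators\<close>

text \<open>\<open>Mr\<close> is an arbitrary choice of largest matchings and may fail to be
  measurable. Its cardinality is a function \<open>\<nu>\<close> of the edge set, since all largest
  matchings of a graph are equally large, and the edge set is a measurable map into the finite set
  \<open>Pow (Pow {1..n})\<close>.\<close>

lemma largest_matching_card_measurable:
  assumes N: "\<And>i k. i \<in> {1..n} \<Longrightarrow> k \<in> {1..n} \<Longrightarrow> Measurable.pred \<Omega> (\<lambda>\<omega>. N (X i \<omega> - X k \<omega>) < r)"
    and Mr: "\<And>\<omega>. \<omega> \<in> space \<Omega> \<Longrightarrow>
      is_largest_matching (geometric_graph n r N (\<lambda>i. X i \<omega>)) (Mr \<omega>)"
  shows "(\<lambda>\<omega>. real (card (Mr \<omega>))) \<in> borel_measurable \<Omega>"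
proof -
  define E where "E \<omega> = snd (geometric_graph n r N (\<lambda>i. X i \<omega>))" for \<omega>
  define \<nu> where "\<nu> F = card (SOME M. is_largest_matching ({1..n}, F) M)" for F :: "nat set set"
  have graph: "geometric_graph n r N (\<lambda>i. X i \<omega>) = ({1..n}, E \<omega>)" for \<omega>
    by (simp add: E_def geometric_graph_def)
  have \<nu>: "card (Mr \<omega>) = \<nu> (E \<omega>)" if "\<omega> \<in> space \<Omega>" for \<omega>
  proof -
    have 1: "is_largest_matching ({1..n}, E \<omega>) (Mr \<omega>)" using Mr[OF that] graph by simp
    then have 2: "is_largest_matching ({1..n}, E \<omega>) (SOME M. is_largest_matching ({1..n}, E \<omega>) M)"
      by (rule someI)
    show ?thesis
      using 1 2 unfolding \<nu>_def is_largest_matching_def is_arg_max_def by (meson nat_neq_iff)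
  qed
  have E_mem: "e \<in> E \<omega> \<longleftrightarrow>
      (\<exists>i\<in>{1..n}. \<exists>k\<in>{1..n}. e = {i, k} \<and> i \<noteq> k \<and> N (X i \<omega> - X k \<omega>) < r)" for e \<omega>
    unfolding E_def geometric_graph_def snd_conv by blast
  have mem[measurable]: "Measurable.pred \<Omega> (\<lambda>\<omega>. e \<in> E \<omega>)" for e
    unfolding E_mem by (intro pred_intros_finite pred_intros_logic N) auto
  have "E \<in> measurable \<Omega> (count_space (Pow (Pow {1..n})))"
  proof (subst measurable_count_space_eq2, simp, intro conjI ballI)
    show "E \<in> space \<Omega> \<rightarrow> Pow (Pow {1..n})" by (auto simp: E_mem)
    fix F :: "nat set set" assume F: "F \<in> Pow (Pow {1..n})"
    \<comment> \<open>Only finitely many candidate edges need testing, so each fibre of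
      \<open>E\<close> is a finite combination of measurable events.\<close>
    have "E \<omega> = F \<longleftrightarrow> (\<forall>e\<in>Pow {1..n}. e \<in> E \<omega> \<longleftrightarrow> e \<in> F)" for \<omega>
    proof -
      have sub: "E \<omega> \<subseteq> Pow {1..n}" by (auto simp: E_mem)
      show ?thesis
      proof (intro iffI equalityI subsetI)
        fix e assume *: "\<forall>e\<in>Pow {1..n}. e \<in> E \<omega> \<longleftrightarrow> e \<in> F"
        { assume "e \<in> E \<omega>" then show "e \<in> F" using * sub by (meson subsetD) }
        { assume "e \<in> F" then show "e \<in> E \<omega>" using * F by (meson PowD subsetD) }
      qed simp
    qed
    then have "E -` {F} \<inter> space \<Omega> = {\<omega> \<in> space \<Omega>. \<forall>e\<in>Pow {1..n}. e \<in> E \<omega> \<longleftrightarrow> e \<in> F}"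
      by (simp add: vimage_def Int_def conj_commute)
    also have "\<dots> \<in> sets \<Omega>"
      by measurable
    finally show "E -` {F} \<inter> space \<Omega> \<in> sets \<Omega>" .
  qed
  from measurable_compose[OF this, of "\<lambda>F. real (\<nu> F)" borel]
  have "(\<lambda>\<omega>. real (\<nu> (E \<omega>))) \<in> borel_measurable \<Omega>" by simp
  also have "?this \<longleftrightarrow> ?thesis"
    by (intro measurable_cong) (simp add: \<nu>)
  finally show ?thesis .
qed

lemma (in prob_space) expectation_of_bool:
  assumes [measurable]: "Measurable.pred M Q"
  shows "expectation (\<lambda>\<omega>. of_bool (Q \<omega>) :: real) = \<P>(\<omega> in M. Q \<omega>)"
    and "integrable M (\<lambda>\<omega>. of_bool (Q \<omega>) :: real)"
proof -
  show "integrable M (\<lambda>\<omega>. of_bool (Q \<omega>) :: real)"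
    by (rule integrable_const_bound[where B=1]) (auto simp: of_bool_def)
  have "expectation (\<lambda>\<omega>. of_bool (Q \<omega>) :: real) = expectation (indicator {\<omega> \<in> space M. Q \<omega>})"
    by (intro Bochner_Integration.integral_cong) (auto split: split_indicator)
  also have "\<dots> = prob ({\<omega> \<in> space M. Q \<omega>} \<inter> space M)" by simp
  also have "{\<omega> \<in> space M. Q \<omega>} \<inter> space M = {\<omega> \<in> space M. Q \<omega>}" by auto
  finally show "expectation (\<lambda>\<omega>. of_bool (Q \<omega>) :: real) = \<P>(\<omega> in M. Q \<omega>)" .
qed

section \<open>The numerical estimate\<close>

text \<open>Here \<open>B\<close> will be \<open>2 ^ d\<close>, \<open>t\<close> will be
  \<open>(r / R) ^ d\<close> and \<open>\<tau>\<close> will be \<open>(s / R) ^ d\<close>. The six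
  factors \<open>b\<close> arise as two from \<open>A \<ge> \<gamma> / b\<close>, three from capping
  \<open>\<tau>\<close>, and one from \<open>1 / B \<ge> 1 / b\<close>.\<close>

lemma edges_minus_cherries_ge:
  fixes n b B A \<gamma> t :: real
  assumes n: "3 \<le> n" and b: "1 \<le> b" "B \<le> b" "0 < B" and \<gamma>: "0 < \<gamma>" "\<gamma> \<le> b * A" and t: "0 < t"
  defines "\<tau> \<equiv> min t (1 / (2 * n * b ^ 3))"
  shows "\<gamma>\<^sup>2 / 16 / b ^ 6 * min (n\<^sup>2 * t) n
    \<le> n * (n - 1) / 2 * (A * (1 / B) * (A * \<tau>) - n * (b * A * \<tau>)\<^sup>2)"
proof -
  have b0: "0 < b" and n0: "0 < n" using b n by auto
  have \<tau>0: "0 < \<tau>" using t n0 b0 by (simp add: \<tau>_def)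
  have "\<tau> \<le> 1 / (2 * n * b ^ 3)" by (simp add: \<tau>_def)
  then have "\<tau> * (2 * n * b ^ 3) \<le> 1" using n0 b0 by (simp add: field_simps)
  then have "n * b\<^sup>2 * \<tau> \<le> 1 / (2 * b)" using b0 by (simp add: field_simps power2_eq_square power3_eq_cube)
  moreover have "1 / b \<le> 1 / B" using b by (simp add: frac_le)
  \<comment> \<open>The cap on \<open>\<tau>\<close> makes the cherry term at most half of
    \<open>1 / b\<close>, hence at most half of the edge term \<open>1 / B\<close>.\<close>
  ultimately have bracket: "1 / (2 * b) \<le> 1 / B - n * b\<^sup>2 * \<tau>" by (simp add: field_simps)
  \<comment> \<open>This is where \<open>n \<ge> 3\<close> enters: the number of pairs is at least a
    third of \<open>n\<^sup>2\<close>.\<close>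
  have "0 \<le> n * (n - 3)" using n by simp
  then have nn: "n\<^sup>2 / 3 \<le> n * (n - 1) / 2" by (simp add: power2_eq_square field_simps)
  have A\<gamma>: "\<gamma>\<^sup>2 / b\<^sup>2 \<le> A\<^sup>2"
  proof -
    have "\<gamma>\<^sup>2 \<le> (b * A)\<^sup>2" using \<gamma> by (intro power_mono) auto
    then show ?thesis using b0 by (simp add: power_mult_distrib field_simps)
  qed
  have b3: "1 \<le> b ^ 3" using b by simp
  \<comment> \<open>If \<open>\<tau> = t\<close>, the term \<open>n\<^sup>2 * t\<close> of the
    minimum decides; if the cap is active, \<open>n\<^sup>2 * \<tau>\<close> equals
    \<open>n / (2 * b ^ 3)\<close>.\<close>
  have min: "min (n\<^sup>2 * t) n / (2 * b ^ 3) \<le> n\<^sup>2 * \<tau>"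
  proof (cases "t \<le> 1 / (2 * n * b ^ 3)")
    case True
    then have "\<tau> = t" by (simp add: \<tau>_def)
    moreover have "n\<^sup>2 * t / (2 * b ^ 3) \<le> n\<^sup>2 * t / 1"
      using b3 b0 t by (intro divide_left_mono) auto
    moreover have "min (n\<^sup>2 * t) n / (2 * b ^ 3) \<le> n\<^sup>2 * t / (2 * b ^ 3)"
      using b0 by (intro divide_right_mono) auto
    ultimately show ?thesis by simp
  next
    case False
    then have "\<tau> = 1 / (2 * n * b ^ 3)" by (simp add: \<tau>_def)
    then have "n\<^sup>2 * \<tau> = n / (2 * b ^ 3)" using n0 by (simp add: power2_eq_square)
    then show ?thesis using b0 by (simp add: divide_right_mono)
  qed
  have min0: "0 \<le> min (n\<^sup>2 * t) n" using n0 t by simp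
  \<comment> \<open>The estimate yields the constant 12 = 3 * 2 * 2, from the pair count, the cap
    and the bracket; 16 leaves slack.\<close>
  have "\<gamma>\<^sup>2 / 16 / b ^ 6 * min (n\<^sup>2 * t) n \<le> \<gamma>\<^sup>2 / 12 / b ^ 6 * min (n\<^sup>2 * t) n"
    using min0 b0 by (intro mult_right_mono divide_right_mono) (auto simp: field_simps)
  also have "\<dots> = \<gamma>\<^sup>2 / b\<^sup>2 * (min (n\<^sup>2 * t) n / (2 * b ^ 3)) / (6 * b)"
  proof -
    have "b ^ 6 = b\<^sup>2 * b ^ 3 * b" by (simp add: eval_nat_numeral)
    then show ?thesis by simp
  qed
  also have "\<dots> \<le> A\<^sup>2 * (n\<^sup>2 * \<tau>) / (6 * b)"
    using A\<gamma> min min0 b0 by (intro divide_right_mono mult_mono) auto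
  also have "\<dots> = n\<^sup>2 / 3 * (A\<^sup>2 * \<tau> * (1 / (2 * b)))" by simp
  also have "\<dots> \<le> n * (n - 1) / 2 * (A\<^sup>2 * \<tau> * (1 / B - n * b\<^sup>2 * \<tau>))"
    using bracket nn \<tau>0 b0 n by (intro mult_mono) auto
  also have "\<dots> = n * (n - 1) / 2 * (A * (1 / B) * (A * \<tau>) - n * (b * A * \<tau>)\<^sup>2)"
    by (simp add: power2_eq_square algebra_simps)
  finally show ?thesis .
qed

section \<open>The lower bound for the expected matching size\<close>

theorem lemma1p2:
  fixes P :: "(real ^ 'd) measure"
    and N :: "real ^ 'd \<Rightarrow> real"
    and f :: "real ^ 'd \<Rightarrow> ennreal"
    and R \<gamma> \<beta> r :: real
    and \<Omega> :: "'w measure"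
    and X :: "nat \<Rightarrow> 'w \<Rightarrow> real ^ 'd"
    and n :: nat
    and Mr :: "'w \<Rightarrow> nat set set"
  assumes "prob_space P"
    and "is_norm N"
    and "R > 0" and "\<gamma> > 0" and "\<beta> \<ge> ln 2"
    and "measure P {x. N x < R} \<ge> \<gamma>"
    and "f \<in> borel_measurable borel" and "P = density lborel f"
    and "esssup (restrict_space lborel {x. N x < R}) f / essinf (restrict_space lborel {x. N x < R}) f
           \<le> ennreal (exp (\<beta> * real CARD('d)))"
    and "prob_space \<Omega>"
    and "prob_space.indep_vars \<Omega> (\<lambda>_. borel) X {1..n}"
    and "\<And>i. i \<in> {1..n} \<Longrightarrow> distr \<Omega> borel (X i) = P"
    and "\<And>\<omega>. \<omega> \<in> space \<Omega> \<Longrightarrow>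
           is_largest_matching (geometric_graph n r N (\<lambda>i. X i \<omega>)) (Mr \<omega>)"
    and "n \<ge> 3" and "r > 0"
  shows "prob_space.expectation \<Omega> (\<lambda>\<omega>. real (card (Mr \<omega>)))
           \<ge> \<gamma>\<^sup>2 / 16 * exp (- 6 * \<beta> * real CARD('d))
             * min ((real n)\<^sup>2 * (r / R) ^ CARD('d)) (real n)"
proof -
  interpret prob_space \<Omega> by fact
  interpret P: prob_space P by fact
  note N = assms(2) and R = assms(3) and X = assms(11) and law = assms(12) and r = assms(15)
  have sP[simp, measurable_cong]: "sets P = sets borel" and spP[simp]: "space P = UNIV"
    using assms(8) by simp_all
  note Nm[measurable] = is_norm_measurable[OF N]
  define d where "d = CARD('d)"
  have d: "0 < d" by (simp add: d_def)
  define b where "b = exp (\<beta> * real d)"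
  \<comment> \<open>The assumption \<open>\<beta> \<ge> ln 2\<close> serves to make \<open>b\<close>
    dominate \<open>2 ^ d\<close>, the cost of halving a radius.\<close>
  have "(2::real) ^ d = exp (real d * ln 2)"
    by (simp add: exp_of_nat_mult)
  also have "\<dots> \<le> b"
    using mult_right_mono[OF assms(5), of "real d"] by (simp add: b_def mult.commute)
  finally have b2: "2 ^ d \<le> b" .
  then have b1: "1 \<le> b"
    by (rule order_trans[rotated]) simp
  have exp6: "exp (- 6 * \<beta> * real d) = 1 / b ^ 6"
    using exp_of_nat_mult[of 6 "\<beta> * real d"]
    by (simp add: b_def exp_minus divide_inverse algebra_simps)
  obtain A where A: "\<gamma> \<le> b * A"
    and ball_ge: "\<And>x s. 0 < s \<Longrightarrow> N x + s \<le> R \<Longrightarrow> A * (s / R) ^ d \<le> measure P {y. N (x - y) < s}"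
    and ball_le: "\<And>x s. 0 < s \<Longrightarrow> measure P {y. N y < R \<and> N (x - y) < s} \<le> b * A * (s / R) ^ d"
    using norm_ball_mass[of f N R \<gamma> b] assms b1 unfolding b_def d_def by auto
  have "0 < b * A" using A assms(4) by linarith
  then have A0: "0 < A" using b1 by (simp add: zero_less_mult_iff)
  define \<tau> where "\<tau> = min ((r / R) ^ d) (1 / (2 * real n * b ^ 3))"
  have n0: "0 < n" using assms(14) by simp
  have \<tau>0: "0 < \<tau>" using r R b1 n0 by (simp add: \<tau>_def)
  \<comment> \<open>The reduced radius is the one for which \<open>(s / R) ^ d\<close> is exactly
    \<open>\<tau>\<close>.\<close>
  define s where "s = R * root d \<tau>"
  have s0: "0 < s" using \<tau>0 R d by (simp add: s_def)
  have sR: "(s / R) ^ d = \<tau>" using \<tau>0 R d by (simp add: s_def)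
  have "(s / R) ^ d \<le> (r / R) ^ d" unfolding sR by (simp add: \<tau>_def)
  then have sr: "s \<le> r"
    using s0 r R d by (simp add: power_mono_iff divide_le_cancel)
  \<comment> \<open>The cap also forces \<open>s \<le> R / 2\<close>, so balls of radius
    \<open>s\<close> around points of the half ball stay inside the ball of radius
    \<open>R\<close>.\<close>
  have "\<tau> \<le> 1 / (2 * real n * b ^ 3)" by (simp add: \<tau>_def)
  also have "\<dots> \<le> 1 / 2 ^ d"
  proof (intro divide_left_mono)
    have "b \<le> b ^ 3" using b1 by (simp add: self_le_power)
    also have "\<dots> \<le> 2 * real n * b ^ 3"
      using mult_right_mono[of 1 "2 * real n" "b ^ 3"] n0 b1 by simp
    finally show "2 ^ d \<le> 2 * real n * b ^ 3" using b2 by simp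
  qed (use b1 n0 in auto)
  finally have "(s / R) ^ d \<le> (1 / 2) ^ d" unfolding sR by (simp add: power_one_over)
  then have "s / R \<le> 1 / 2"
    using s0 R d by (subst (asm) power_mono_iff) auto
  then have sR2: "s \<le> R / 2"
    using R by (simp add: field_simps)

  \<comment> \<open>Adjacency in the thinned graph: radius \<open>s\<close>, and both points in the
    ball where the density is controlled.\<close>
  define J where "J x y \<longleftrightarrow> N x < R \<and> N y < R \<and> N (x - y) < s" for x y
  have J_sym: "J x y \<Longrightarrow> J y x" for x y
    using is_norm_minus_commute[OF N, of x y] by (simp add: J_def)
  have J_meas[measurable]: "Measurable.pred (borel \<Otimes>\<^sub>M borel) (\<lambda>(x, y). J x y)"
    unfolding J_def by measurable
  \<comment> \<open>In \<open>q\<close>, the factor \<open>A * (1 / 2 ^ d)\<close> bounds the mass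
    of the half ball, where one end is placed, and \<open>A * \<tau>\<close> that of the ball of
    radius \<open>s\<close> around it. The number \<open>c\<close> bounds the mass of all neighbours
    of a point.\<close>
  define q where "q = A * (1 / 2 ^ d) * (A * \<tau>)"
  define c where "c = b * A * \<tau>"
  have edge: "q \<le> \<P>(\<omega> in \<Omega>. J (X i \<omega>) (X k \<omega>))"
    if "i \<in> {1..n}" "k \<in> {1..n}" "i \<noteq> k" for i k
  proof -
    define D where "D = {x. N (0 - x) < R / 2}"
    have "N 0 = 0" using N unfolding is_norm_def by blast
    then have "A * (1 / 2 ^ d) \<le> measure P D"
      using ball_ge[of "R / 2" 0] R by (simp add: D_def power_one_over)
    then have "q \<le> measure P D * (A * \<tau>)"
      unfolding q_def using A0 \<tau>0 by (intro mult_right_mono) auto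
    also have "\<dots> \<le> \<P>(\<omega> in \<Omega>. J (X i \<omega>) (X k \<omega>))"
    proof (rule iid_pair_prob_ge[OF X that law _ J_meas])
      show "D \<in> sets borel" unfolding D_def by measurable
      fix x assume "x \<in> D"
      then have x: "N x < R / 2"
        using is_norm_minus_commute[OF N, of 0 x] by (simp add: D_def)
      have "{y. N (x - y) < s} \<subseteq> {y. J x y}"
      proof
        fix y assume y: "y \<in> {y. N (x - y) < s}"
        have "N y \<le> N x + N (x - y)" by (rule is_norm_triangle_sub[OF N])
        then show "y \<in> {y. J x y}" using x y sR2 R by (simp add: J_def)
      qed
      moreover have "{y. J x y} \<in> sets P" unfolding J_def by measurable
      ultimately have "measure P {y. N (x - y) < s} \<le> measure P {y. J x y}"
        by (rule P.finite_measure_mono)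
      then show "A * \<tau> \<le> measure P {y. J x y}"
        using ball_ge[of s x] x s0 sR2 sR by simp
    qed (use A0 \<tau>0 in auto)
    finally show ?thesis .
  qed
  have cherry: "\<P>(\<omega> in \<Omega>. J (X j \<omega>) (X i \<omega>) \<and> J (X j \<omega>) (X k \<omega>)) \<le> c\<^sup>2"
    if "i \<in> {1..n}" "k \<in> {1..n}" "j \<in> {1..n}" "i \<noteq> k" "j \<noteq> i" "j \<noteq> k" for i k j
  proof (rule iid_cherry_prob_le[OF X that law J_meas])
    fix x
    have "measure P {y. J x y} \<le> measure P {y. N y < R \<and> N (x - y) < s}"
      by (rule P.finite_measure_mono) (auto simp: J_def)
    then show "measure P {y. J x y} \<le> c"
      using ball_le[OF s0, of x] by (simp add: c_def sR)
  qed

  define Q where "Q = {(i, k). i \<in> {1..n} \<and> k \<in> {1..n} \<and> i < k}"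
  have finQ: "finite Q"
    by (rule finite_subset[of _ "{1..n} \<times> {1..n}"]) (auto simp: Q_def)
  have Xm: "X i \<in> borel_measurable \<Omega>" if "i \<in> {1..n}" for i
    using X that by (auto simp: indep_vars_def)
  have JX: "Measurable.pred \<Omega> (\<lambda>\<omega>. J (X i \<omega>) (X k \<omega>))" if "i \<in> {1..n}" "k \<in> {1..n}" for i k
  proof -
    note [measurable] = Xm[OF that(1)] Xm[OF that(2)]
    show ?thesis unfolding J_def by measurable
  qed
  have cherry_meas: "Measurable.pred \<Omega>
      (\<lambda>\<omega>. j \<noteq> i \<and> j \<noteq> k \<and> J (X j \<omega>) (X i \<omega>) \<and> J (X j \<omega>) (X k \<omega>))"
    if "i \<in> {1..n}" "k \<in> {1..n}" "j \<in> {1..n}" for i k j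
    using JX that by (intro pred_intros_logic) auto
  \<comment> \<open>The share of the pair \<open>i < k\<close>: its edge indicator minus the number
    of cherries with ends \<open>i\<close> and \<open>k\<close>.\<close>
  define W :: "nat \<times> nat \<Rightarrow> 'w \<Rightarrow> real" where "W = (\<lambda>(i, k) \<omega>. of_bool (J (X i \<omega>) (X k \<omega>)) -
    (\<Sum>j\<in>{1..n}. of_bool (j \<noteq> i \<and> j \<noteq> k \<and> J (X j \<omega>) (X i \<omega>) \<and> J (X j \<omega>) (X k \<omega>))))"
  have W: "integrable \<Omega> (W p) \<and> q - real n * c\<^sup>2 \<le> expectation (W p)" if "p \<in> Q" for p
  proof -
    obtain i k where p: "p = (i, k)" "i \<in> {1..n}" "k \<in> {1..n}" "i < k"
      using \<open>p \<in> Q\<close> unfolding Q_def by blast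
    let ?C = "\<lambda>j \<omega>. j \<noteq> i \<and> j \<noteq> k \<and> J (X j \<omega>) (X i \<omega>) \<and> J (X j \<omega>) (X k \<omega>)"
    have int: "integrable \<Omega> (\<lambda>\<omega>. of_bool (J (X i \<omega>) (X k \<omega>)) :: real)"
      "\<And>j. j \<in> {1..n} \<Longrightarrow> integrable \<Omega> (\<lambda>\<omega>. of_bool (?C j \<omega>) :: real)"
      using p by (auto intro!: expectation_of_bool(2) JX cherry_meas simp del: of_bool_conj)
    \<comment> \<open>For \<open>j = i\<close> or \<open>j = k\<close> the event is empty, so the
      sum may run over all \<open>n\<close> indices.\<close>
    have "\<P>(\<omega> in \<Omega>. ?C j \<omega>) \<le> c\<^sup>2" if "j \<in> {1..n}" for j
      using cherry[of i k j] p that by (cases "j = i \<or> j = k") auto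
    then have "(\<Sum>j\<in>{1..n}. \<P>(\<omega> in \<Omega>. ?C j \<omega>)) \<le> real n * c\<^sup>2"
      using sum_bounded_above[of "{1..n}" "\<lambda>j. \<P>(\<omega> in \<Omega>. ?C j \<omega>)" "c\<^sup>2"] by simp
    moreover have "q \<le> \<P>(\<omega> in \<Omega>. J (X i \<omega>) (X k \<omega>))"
      using edge p by simp
    moreover have "expectation (W p)
        = \<P>(\<omega> in \<Omega>. J (X i \<omega>) (X k \<omega>)) - (\<Sum>j\<in>{1..n}. \<P>(\<omega> in \<Omega>. ?C j \<omega>))"
    proof -
      have "expectation (W p) = expectation (\<lambda>\<omega>. of_bool (J (X i \<omega>) (X k \<omega>)))
          - (\<Sum>j\<in>{1..n}. expectation (\<lambda>\<omega>. of_bool (?C j \<omega>)))"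
        unfolding W_def p(1) prod.case
        by (simp only: Bochner_Integration.integral_diff[OF int(1) Bochner_Integration.integrable_sum[OF int(2)]]
            Bochner_Integration.integral_sum[OF int(2)])
      also have "(\<Sum>j\<in>{1..n}. expectation (\<lambda>\<omega>. of_bool (?C j \<omega>)))
          = (\<Sum>j\<in>{1..n}. \<P>(\<omega> in \<Omega>. ?C j \<omega>))"
        using p by (intro sum.cong refl expectation_of_bool(1) cherry_meas)
      finally show ?thesis
        using expectation_of_bool(1)[OF JX[OF p(2,3)]] by simp
    qed
    moreover have "integrable \<Omega> (W p)"
      unfolding W_def p(1) prod.case using int
      by (intro Bochner_Integration.integrable_diff Bochner_Integration.integrable_sum)
    ultimately show ?thesis by linarith
  qed

  have W_le: "(\<Sum>p\<in>Q. W p \<omega>) \<le> real (card (Mr \<omega>))" if "\<omega> \<in> space \<Omega>" for \<omega>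
  proof -
    have eq: "(\<Sum>p\<in>Q. W p \<omega>) = (\<Sum>(i, k)\<in>Q. of_bool (J (X i \<omega>) (X k \<omega>)) - (\<Sum>j\<in>{1..n}.
        of_bool (j \<noteq> i \<and> j \<noteq> k \<and> J (X j \<omega>) (X i \<omega>) \<and> J (X j \<omega>) (X k \<omega>))))"
      by (simp only: W_def case_prod_beta')
    have "\<exists>M\<subseteq>{{i, k} | i k. i \<in> {1..n} \<and> k \<in> {1..n} \<and> i \<noteq> k \<and> J (X i \<omega>) (X k \<omega>)}.
      (\<forall>e\<in>M. \<forall>e'\<in>M. e \<noteq> e' \<longrightarrow> e \<inter> e' = {}) \<and> (\<Sum>p\<in>Q. W p \<omega>) \<le> real (card M)"
      unfolding eq unfolding Q_def by (rule exists_matching_edges_minus_cherries) (auto intro: J_sym)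
    then obtain M where M: "M \<subseteq> {{i, k} | i k. i \<in> {1..n} \<and> k \<in> {1..n} \<and> i \<noteq> k \<and> J (X i \<omega>) (X k \<omega>)}"
      "\<forall>e\<in>M. \<forall>e'\<in>M. e \<noteq> e' \<longrightarrow> e \<inter> e' = {}" "(\<Sum>p\<in>Q. W p \<omega>) \<le> real (card M)"
      by (elim exE conjE)
    \<comment> \<open>Since \<open>s \<le> r\<close>, a matching of the thinned graph is one of the
      original graph.\<close>
    have "M \<subseteq> snd (geometric_graph n r N (\<lambda>i. X i \<omega>))"
    proof
      fix e assume "e \<in> M"
      then obtain i k where "e = {i, k}" "i \<in> {1..n}" "k \<in> {1..n}" "i \<noteq> k" "J (X i \<omega>) (X k \<omega>)"
        using M(1) by blast
      moreover from this(5) have "N (X i \<omega> - X k \<omega>) < r" using sr by (simp add: J_def)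
      ultimately show "e \<in> snd (geometric_graph n r N (\<lambda>i. X i \<omega>))"
        unfolding geometric_graph_def snd_conv by blast
    qed
    then have "card M \<le> card (Mr \<omega>)"
      using assms(13)[OF that] M(2)
      unfolding is_largest_matching_def is_arg_max_def is_matching_def by (meson not_le)
    then show ?thesis using M(3) by linarith
  qed
  have Mr_int: "integrable \<Omega> (\<lambda>\<omega>. real (card (Mr \<omega>)))"
  proof (rule integrable_const_bound[where B="real (card (Pow {1..n}))"])
    show "(\<lambda>\<omega>. real (card (Mr \<omega>))) \<in> borel_measurable \<Omega>"
    proof (rule largest_matching_card_measurable[OF _ assms(13)])
      fix i k assume "i \<in> {1..n}" "k \<in> {1..n}"
      note [measurable] = this[THEN Xm]
      show "Measurable.pred \<Omega> (\<lambda>\<omega>. N (X i \<omega> - X k \<omega>) < r)" by measurable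
    qed
    have "Mr \<omega> \<subseteq> Pow {1..n}" if "\<omega> \<in> space \<Omega>" for \<omega>
      using assms(13)[OF that]
      unfolding is_largest_matching_def is_arg_max_def is_matching_def geometric_graph_def by auto
    then show "AE \<omega> in \<Omega>. norm (real (card (Mr \<omega>))) \<le> real (card (Pow {1..n}))"
      by (intro AE_I2) (simp add: card_mono del: card_Pow)
  qed
  \<comment> \<open>The numerical estimate is used with \<open>B = 2 ^ d\<close>; linearity of
    expectation over the pairs then finishes the proof.\<close>
  have "\<gamma>\<^sup>2 / 16 / b ^ 6 * min ((real n)\<^sup>2 * (r / R) ^ d) (real n)
      \<le> real n * (real n - 1) / 2 * (q - real n * c\<^sup>2)"
    unfolding q_def c_def \<tau>_def
    using assms(4,14) A b1 b2 r R by (intro edges_minus_cherries_ge) auto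
  also have "\<dots> = real (card Q) * (q - real n * c\<^sup>2)"
    using card_increasing_pairs[of n] by (simp add: Q_def)
  also have "\<dots> \<le> (\<Sum>p\<in>Q. expectation (W p))"
    using W by (intro sum_bounded_below) auto
  also have "\<dots> = expectation (\<lambda>\<omega>. \<Sum>p\<in>Q. W p \<omega>)"
    using W by (intro Bochner_Integration.integral_sum[symmetric]) auto
  also have "\<dots> \<le> expectation (\<lambda>\<omega>. real (card (Mr \<omega>)))"
    using W W_le Mr_int by (intro integral_mono Bochner_Integration.integrable_sum) auto
  finally show ?thesis
    unfolding exp6[unfolded d_def] d_def by simp
qed

end
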